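(* Let $n\geq 1$ and let $\rho$ be a faithful linear representation of $\mathrm{K}_n$ over some field. Then $\dim\rho\geq n$.
   Context: For a positive integer $n$, Kiselman's semigroup $\mathrm{K}_n$ is the monoid (with unit element $e$) given by the monoid presentation with generators $a_1,\dots,a_n$ and relations $a_i^2=a_i$ for $i=1,\dots,n$, and $a_ia_ja_i=a_ja_ia_j=a_ja_i$ for all $1\leq i<j\leq n$. A linear representation of $\mathrm{K}_n$ over a field is a homomorphism from $\mathrm{K}_n$ to the monoid of linear operators on a vector space $V$ over that field; its dimension is $\dim V$; it is faithful if it is injective as a map. *)

theory Defs
  imports "HOL-Algebra.Group" "HOL-Library.Extended_Nat"
begin

section \<open>Monoid presentations\<close>

text \<open>Words over \<open>X\<close> are lists, the unit is the empty word, and the relations \<open>R\<close>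
  are pairs of words. The rule \<open>rel\<close> requires both sides to be words over \<open>X\<close>, so the
  result is always a congruence on \<open>lists X\<close>.\<close>

inductive_set pres_cong :: "'a set \<Rightarrow> ('a list \<times> 'a list) set \<Rightarrow> ('a list \<times> 'a list) set"
  for X :: "'a set" and R :: "('a list \<times> 'a list) set"
where
  rel: "(u, v) \<in> R \<Longrightarrow> u \<in> lists X \<Longrightarrow> v \<in> lists X \<Longrightarrow> (u, v) \<in> pres_cong X R"
| refl: "u \<in> lists X \<Longrightarrow> (u, u) \<in> pres_cong X R"
| sym: "(u, v) \<in> pres_cong X R \<Longrightarrow> (v, u) \<in> pres_cong X R"
| trans: "(u, v) \<in> pres_cong X R \<Longrightarrow> (v, w) \<in> pres_cong X R \<Longrightarrow> (u, w) \<in> pres_cong X R"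
| append: "(u, u') \<in> pres_cong X R \<Longrightarrow> (v, v') \<in> pres_cong X R \<Longrightarrow>
    (u @ v, u' @ v') \<in> pres_cong X R"

definition presented_monoid :: "'a set \<Rightarrow> ('a list \<times> 'a list) set \<Rightarrow> 'a list set monoid" where
  "presented_monoid X R =
    \<lparr> carrier = lists X // pres_cong X R,
      monoid.mult = (\<lambda>A B. \<Union>u\<in>A. \<Union>v\<in>B. pres_cong X R `` {u @ v}),
      one = pres_cong X R `` {[]} \<rparr>"

lemma pres_cong_lists:
  "(u, v) \<in> pres_cong X R \<Longrightarrow> u \<in> lists X \<and> v \<in> lists X"
  by (induction rule: pres_cong.induct) auto

lemma equiv_pres_cong: "equiv (lists X) (pres_cong X R)"
  by (rule equivI)
    (auto simp: refl_on_def sym_def trans_def dest: pres_cong_lists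
      intro: pres_cong.refl pres_cong.sym pres_cong.trans)

lemma presented_monoid_mult_class:
  assumes "u \<in> lists X" "v \<in> lists X"
  shows "pres_cong X R `` {u} \<otimes>\<^bsub>presented_monoid X R\<^esub> pres_cong X R `` {v} =
    pres_cong X R `` {u @ v}"
proof -
  have "congruent2 (pres_cong X R) (pres_cong X R) (\<lambda>u v. pres_cong X R `` {u @ v})"
    by (rule congruent2I') (rule equiv_class_eq[OF equiv_pres_cong], rule pres_cong.append)
  then show ?thesis
    using UN_equiv_class2[OF equiv_pres_cong equiv_pres_cong _ assms]
    by (simp add: presented_monoid_def)
qed

lemma monoid_presented_monoid: "monoid (presented_monoid X R)"
proof -
  let ?M = "presented_monoid X R" and ?c = "\<lambda>u. pres_cong X R `` {u}"
  have carr: "carrier ?M = ?c ` lists X"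
    by (auto simp: presented_monoid_def quotient_def)
  have one: "\<one>\<^bsub>?M\<^esub> = ?c []"
    by (simp add: presented_monoid_def)
  have mult: "?c u \<otimes>\<^bsub>?M\<^esub> ?c v = ?c (u @ v)" if "u \<in> lists X" "v \<in> lists X" for u v
    using that by (rule presented_monoid_mult_class)
  have nil: "[] \<in> lists X" by simp
  have app: "u @ v \<in> lists X" if "u \<in> lists X" "v \<in> lists X" for u v
    using that by simp
  show ?thesis
  proof (rule monoidI)
    fix x y assume "x \<in> carrier ?M" "y \<in> carrier ?M"
    then obtain u v where *: "u \<in> lists X" "v \<in> lists X" "x = ?c u" "y = ?c v"
      unfolding carr by blast
    show "x \<otimes>\<^bsub>?M\<^esub> y \<in> carrier ?M"
      unfolding *(3,4) mult[OF *(1,2)] carr using app[OF *(1,2)] by (rule imageI)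
  next
    show "\<one>\<^bsub>?M\<^esub> \<in> carrier ?M"
      unfolding one carr using nil by (rule imageI)
  next
    fix x y z assume "x \<in> carrier ?M" "y \<in> carrier ?M" "z \<in> carrier ?M"
    then obtain u v w where *: "u \<in> lists X" "v \<in> lists X" "w \<in> lists X"
      and e: "x = ?c u" "y = ?c v" "z = ?c w"
      unfolding carr by blast
    show "x \<otimes>\<^bsub>?M\<^esub> y \<otimes>\<^bsub>?M\<^esub> z = x \<otimes>\<^bsub>?M\<^esub> (y \<otimes>\<^bsub>?M\<^esub> z)"
      unfolding e mult[OF *(1,2)] mult[OF *(2,3)] mult[OF app[OF *(1,2)] *(3)]
        mult[OF *(1) app[OF *(2,3)]] append_assoc ..
  next
    fix x assume "x \<in> carrier ?M"
    then obtain u where *: "u \<in> lists X" "x = ?c u" unfolding carr by blast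
    show "\<one>\<^bsub>?M\<^esub> \<otimes>\<^bsub>?M\<^esub> x = x"
      unfolding *(2) one mult[OF nil *(1)] append_Nil ..
    show "x \<otimes>\<^bsub>?M\<^esub> \<one>\<^bsub>?M\<^esub> = x"
      unfolding *(2) one mult[OF *(1) nil] append_Nil2 ..
  qed
qed


section \<open>Kiselman's semigroup\<close>

text \<open>The generator \<open>a\<^sub>i\<close> is the letter \<open>i\<close>.\<close>

definition kiselman_relations :: "nat \<Rightarrow> (nat list \<times> nat list) set" where
  "kiselman_relations n =
    {([i, i], [i]) | i. 1 \<le> i \<and> i \<le> n} \<union>
    {([i, j, i], [j, i]) | i j. 1 \<le> i \<and> i < j \<and> j \<le> n} \<union>
    {([j, i, j], [j, i]) | i j. 1 \<le> i \<and> i < j \<and> j \<le> n}"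

definition kiselman :: "nat \<Rightarrow> nat list set monoid" where
  "kiselman n = presented_monoid {1..n} (kiselman_relations n)"


section \<open>Linear representations\<close>

text \<open>A vector space over the field \<open>'k\<close> is a type \<open>'v\<close> together with a scalar
  multiplication satisfying the locale \<^locale>\<open>vector_space\<close>.\<close>

definition linear_operators ::
    "('k::field \<Rightarrow> 'v::ab_group_add \<Rightarrow> 'v) \<Rightarrow> ('v \<Rightarrow> 'v) monoid" where
  "linear_operators scale =
    \<lparr> carrier = {f. Vector_Spaces.linear scale scale f}, monoid.mult = (\<circ>), one = id \<rparr>"

text \<open>The library's \<^const>\<open>hom\<close> only asks for compatibility with the multiplication.\<close>

definition linear_representation ::
    "('a, 'b) monoid_scheme \<Rightarrow> ('k::field \<Rightarrow> 'v::ab_group_add \<Rightarrow> 'v) \<Rightarrow> ('a \<Rightarrow> 'v \<Rightarrow> 'v) \<Rightarrow> bool" where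
  "linear_representation M scale \<rho> \<longleftrightarrow>
    vector_space scale \<and> \<rho> \<in> hom M (linear_operators scale) \<and>
    \<rho> \<one>\<^bsub>M\<^esub> = \<one>\<^bsub>linear_operators scale\<^esub>"

definition faithful_representation ::
    "('a, 'b) monoid_scheme \<Rightarrow> ('k::field \<Rightarrow> 'v::ab_group_add \<Rightarrow> 'v) \<Rightarrow> ('a \<Rightarrow> 'v \<Rightarrow> 'v) \<Rightarrow> bool" where
  "faithful_representation M scale \<rho> \<longleftrightarrow>
    linear_representation M scale \<rho> \<and> inj_on \<rho> (carrier M)"

text \<open>The library's \<open>vector_space.dim\<close> is a natural number, hence not meaningful for
  infinite-dimensional spaces.\<close>

definition vdim :: "('k::field \<Rightarrow> 'v::ab_group_add \<Rightarrow> 'v) \<Rightarrow> enat" where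
  "vdim scale =
    (if \<exists>B. finite B \<and> module.span scale B = UNIV
     then enat (vector_space.dim scale UNIV) else \<infinity>)"

end

(* The products e\<^sub>k = a\<^sub>k \<dots> a\<^sub>1, k = 0, \<dots>, n, satisfy a\<^sub>i e\<^sub>k = e\<^sub>k for i \<le> k, hence form a
   decreasing chain of idempotents. They are pairwise distinct, because the defining relations
   preserve the set of letters of a word. A faithful representation therefore sends them to
   idempotent operators whose ranges form a strictly decreasing chain of n + 1 subspaces. *)

theory Submission
  imports Defs
begin

text \<open>The letters of a concatenation are the union of the letters of its factors, so the
  invariant survives every closure rule. It serves to tell classes of words apart.\<close>

lemma pres_cong_set_eq:
  assumes "(u, v) \<in> pres_cong X R" and "\<And>u v. (u, v) \<in> R \<Longrightarrow> set u = set v"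
  shows "set u = set v"
  using assms(1) by (induction rule: pres_cong.induct) (auto dest: assms(2))

lemma kiselman_relations_set_eq:
  "(u, v) \<in> kiselman_relations n \<Longrightarrow> set u = set v"
  by (auto simp: kiselman_relations_def)

lemma pres_cong_Cons:
  assumes "x \<in> X" "(u, v) \<in> pres_cong X R"
  shows "(x # u, x # v) \<in> pres_cong X R"
  using pres_cong.append[OF pres_cong.refl[of "[x]"] assms(2)] assms(1) by simp

abbreviation kiselman_cong :: "nat \<Rightarrow> (nat list \<times> nat list) set" where
  "kiselman_cong n \<equiv> pres_cong {1..n} (kiselman_relations n)"

primrec desc_word :: "nat \<Rightarrow> nat list" where
  "desc_word 0 = []"
| "desc_word (Suc k) = Suc k # desc_word k"

lemma set_desc_word: "set (desc_word k) = {1..k}"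
  by (induction k) auto

lemma desc_word_in_lists: "k \<le> n \<Longrightarrow> desc_word k \<in> lists {1..n}"
  by (auto simp: in_lists_conv_set set_desc_word)

text \<open>By induction on \<open>k\<close>: a leading letter \<open>i = Suc k\<close> merges with
  the head of the word by idempotence, and a smaller one must be carried past that head.\<close>

lemma letter_absorbed:
  assumes "1 \<le> i" "i \<le> k" "k \<le> n"
  shows "(i # desc_word k, desc_word k) \<in> kiselman_cong n"
  using assms
proof (induction k)
  case 0
  then show ?case by simp
next
  case (Suc k)
  have w: "desc_word k \<in> lists {1..n}"
    using Suc.prems by (intro desc_word_in_lists) simp
  show ?case
  proof (cases "i = Suc k")
    case True
    have "([i, i], [i]) \<in> kiselman_cong n"
      using Suc.prems by (intro pres_cong.rel) (auto simp: kiselman_relations_def)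
    from pres_cong.append[OF this pres_cong.refl[OF w]] show ?thesis
      using True by simp
  next
    case False
    then have IH: "(i # desc_word k, desc_word k) \<in> kiselman_cong n"
      using Suc by simp
    have IH': "(Suc k # i # desc_word k, Suc k # desc_word k) \<in> kiselman_cong n"
      using IH Suc.prems by (intro pres_cong_Cons) simp_all
    \<comment> \<open>The induction hypothesis read backwards creates a second \<open>i\<close>
      behind \<open>Suc k\<close>. The relation for \<open>[i, Suc k, i]\<close> then deletes the
      first \<open>i\<close>, and \<open>IH'\<close> deletes the second.\<close>
    have "(i # Suc k # desc_word k, i # Suc k # i # desc_word k) \<in> kiselman_cong n"
      using Suc.prems by (intro pres_cong_Cons[OF _ pres_cong.sym[OF IH']]) simp
    moreover have "([i, Suc k, i], [Suc k, i]) \<in> kiselman_cong n"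
      using Suc.prems False by (intro pres_cong.rel) (auto simp: kiselman_relations_def)
    from pres_cong.append[OF this pres_cong.refl[OF w]]
    have "(i # Suc k # i # desc_word k, Suc k # i # desc_word k) \<in> kiselman_cong n"
      by simp
    ultimately show ?thesis
      using IH' by (auto intro: pres_cong.trans)
  qed
qed

text \<open>For \<open>u = desc_word j\<close> with \<open>j \<le> k\<close> this gives the product
  of two members of the chain, and for \<open>j = k\<close> idempotence.\<close>

lemma word_absorbed:
  assumes "set u \<subseteq> {1..k}" "k \<le> n"
  shows "(u @ desc_word k, desc_word k) \<in> kiselman_cong n"
  using assms
proof (induction u)
  case Nil
  then show ?case using pres_cong.refl[OF desc_word_in_lists] by simp
next
  case (Cons i u)
  then have "(i # u @ desc_word k, i # desc_word k) \<in> kiselman_cong n"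
    by (intro pres_cong_Cons) auto
  moreover have "(i # desc_word k, desc_word k) \<in> kiselman_cong n"
    using Cons.prems by (intro letter_absorbed) auto
  ultimately show ?case by (auto intro: pres_cong.trans)
qed

text \<open>The product in the opposite order: behind the letter \<open>Suc k\<close>, the repeated
  \<open>desc_word k\<close> collapses by idempotence.\<close>

lemma desc_word_Suc_append:
  assumes "Suc k \<le> n"
  shows "(desc_word (Suc k) @ desc_word k, desc_word (Suc k)) \<in> kiselman_cong n"
proof -
  have "(Suc k # desc_word k @ desc_word k, Suc k # desc_word k) \<in> kiselman_cong n"
    using assms by (intro pres_cong_Cons word_absorbed) (simp_all add: set_desc_word)
  then show ?thesis by simp
qed

lemma (in vector_space) length_subspace_chain_le_dim:
  assumes "finite B" "span B = UNIV"
    and "\<And>k. k \<le> n \<Longrightarrow> subspace (S k)"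
    and "\<And>k. k < n \<Longrightarrow> S (Suc k) \<subset> S k"
  shows "n \<le> dim UNIV"
proof -
  \<comment> \<open>\<open>B\<close> merely spans, while the finite-dimensional locale asks for a
    basis; one is extracted from \<open>B\<close>.\<close>
  obtain C where C: "C \<subseteq> B" "independent C" "B \<subseteq> span C"
    using maximal_independent_subset[of B] by blast
  have "span C = UNIV"
    using span_mono[OF C(3)] assms(2) by (simp add: span_span top.extremum_unique)
  then interpret finite_dimensional_vector_space scale C
    using C assms(1) by unfold_locales (auto intro: finite_subset)
  \<comment> \<open>Each strict inclusion costs at least one dimension.\<close>
  have "k \<le> n \<Longrightarrow> dim (S k) + k \<le> dim UNIV" for k
  proof (induction k)
    case 0
    then show ?case unfolding add_0_right by (intro dim_subset subset_UNIV)
  next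
    case (Suc k)
    then have "span (S (Suc k)) \<subset> span (S k)"
      using assms(3)[of "Suc k"] assms(3)[of k] assms(4)[of k] by (simp add: span_eq_iff[THEN iffD2])
    from dim_psubset[OF this] show ?case
      using Suc by simp
  qed
  from this[of n] show ?thesis by simp
qed

theorem proposition31:
  fixes n :: nat
    and scale :: "'k::field \<Rightarrow> 'v::ab_group_add \<Rightarrow> 'v"
    and \<rho> :: "nat list set \<Rightarrow> 'v \<Rightarrow> 'v"
  assumes "n \<ge> 1"
    and "faithful_representation (kiselman n) scale \<rho>"
  shows "vdim scale \<ge> enat n"
proof -
  let ?c = "\<lambda>u. kiselman_cong n `` {u}"
  define F where "F = (\<lambda>u. \<rho> (?c u))"
  interpret vector_space scale
    using assms(2) by (simp add: faithful_representation_def linear_representation_def)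
  have hom: "\<rho> \<in> hom (kiselman n) (linear_operators scale)"
    and inj: "inj_on \<rho> (carrier (kiselman n))"
    using assms(2) by (auto simp: faithful_representation_def linear_representation_def)
  have carr: "?c u \<in> carrier (kiselman n)" if "u \<in> lists {1..n}" for u
    using that by (auto simp: kiselman_def presented_monoid_def intro: quotientI)
  have lin: "Vector_Spaces.linear scale scale (F u)" if "u \<in> lists {1..n}" for u
    using hom carr[OF that] by (auto simp: hom_def linear_operators_def F_def)
  have app: "F (u @ v) = F u \<circ> F v" if "u \<in> lists {1..n}" "v \<in> lists {1..n}" for u v
  proof -
    have "F (u @ v) = \<rho> (?c u \<otimes>\<^bsub>kiselman n\<^esub> ?c v)"
      unfolding kiselman_def presented_monoid_mult_class[OF that] F_def ..
    also have "\<dots> = F u \<circ> F v"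
      using hom_mult[OF hom carr[OF that(1)] carr[OF that(2)]]
      by (simp add: linear_operators_def F_def)
    finally show ?thesis .
  qed
  have F_eq: "F u = F v" if "(u, v) \<in> kiselman_cong n" for u v
    using equiv_class_eq[OF equiv_pres_cong that] by (simp add: F_def)
  \<comment> \<open>Faithfulness enters here: equal operators come from congruent words, which share
    their letters.\<close>
  have F_inj: "set u = set v" if "F u = F v" "u \<in> lists {1..n}" "v \<in> lists {1..n}" for u v
  proof -
    have "?c u = ?c v"
      using inj_onD[OF inj] that carr by (simp add: F_def)
    then have "(u, v) \<in> kiselman_cong n"
      using eq_equiv_class[OF _ equiv_pres_cong] that(3) by blast
    then show ?thesis
      by (rule pres_cong_set_eq) (rule kiselman_relations_set_eq)
  qed
  define e where "e k = F (desc_word k)" for k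
  \<comment> \<open>Thus \<open>e j\<close> fixes the range of \<open>e k\<close> pointwise.\<close>
  have absorb: "e j (e k v) = e k v" if "j \<le> k" "k \<le> n" for j k v
  proof -
    have "e j \<circ> e k = F (desc_word j @ desc_word k)"
      unfolding e_def using that by (intro app[symmetric] desc_word_in_lists) simp_all
    also have "\<dots> = e k"
      unfolding e_def using that by (intro F_eq word_absorbed) (auto simp: set_desc_word)
    finally show ?thesis by (rule comp_eq_dest_lhs)
  qed
  have right: "e (Suc k) (e k v) = e (Suc k) v" if "k < n" for k v
  proof -
    have "e (Suc k) \<circ> e k = F (desc_word (Suc k) @ desc_word k)"
      unfolding e_def using that by (intro app[symmetric] desc_word_in_lists) simp_all
    also have "\<dots> = e (Suc k)"
      unfolding e_def using that by (intro F_eq desc_word_Suc_append) simp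
    finally show ?thesis by (rule comp_eq_dest_lhs)
  qed
  have strict: "range (e (Suc k)) \<subset> range (e k)" if "k < n" for k
  proof
    show "range (e (Suc k)) \<subseteq> range (e k)"
    proof (rule image_subsetI)
      fix v
      have "e (Suc k) v = e k (e (Suc k) v)"
        using absorb[of k "Suc k" v] that by simp
      then show "e (Suc k) v \<in> range (e k)" by (rule range_eqI)
    qed
    show "range (e (Suc k)) \<noteq> range (e k)"
    proof
      assume eq: "range (e (Suc k)) = range (e k)"
      \<comment> \<open>If the ranges agree, \<open>e k v\<close> lies in the range of
        \<open>e (Suc k)\<close> and is fixed by it, whereas \<open>right\<close> says that
        \<open>e (Suc k)\<close> sends it to \<open>e (Suc k) v\<close>.\<close>
      have "e (Suc k) v = e k v" for v
      proof -
        obtain w where w: "e k v = e (Suc k) w"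
          using eq by blast
        have "e (Suc k) v = e (Suc k) (e (Suc k) w)"
          using right[OF that, of v] w by simp
        also have "\<dots> = e k v"
          using absorb[of "Suc k" "Suc k" w] that w by simp
        finally show ?thesis .
      qed
      then have "F (desc_word (Suc k)) = F (desc_word k)"
        unfolding e_def by (rule ext)
      then have "set (desc_word (Suc k)) = set (desc_word k)"
        using that by (intro F_inj desc_word_in_lists) simp_all
      then have "Suc k \<in> {1..k}"
        by (subst set_desc_word[symmetric]) auto
      then show False by simp
    qed
  qed
  have sub: "subspace (range (e k))" if "k \<le> n" for k
  proof -
    interpret Vector_Spaces.linear scale scale "e k"
      unfolding e_def using that by (intro lin desc_word_in_lists)
    show ?thesis by (rule subspace_image) (rule subspace_UNIV)
  qed
  \<comment> \<open>Without a finite spanning set \<open>vdim scale\<close> is infinite and the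
    bound is immediate.\<close>
  have "n \<le> dim UNIV" if "finite B" "span B = UNIV" for B
    using length_subspace_chain_le_dim[where S = "\<lambda>k. range (e k)", OF that sub strict] .
  then show ?thesis
    by (auto simp: vdim_def)
qed

end
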